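(* Let $\alpha_0,\alpha_1,\alpha_2,\eta$ be complex parameters with $\alpha_0+\alpha_1+\alpha_2=1$. The system $$\begin{aligned} \frac{dx}{dt}&=-(xw-\alpha_2)x+\frac12,\\ \frac{dy}{dt}&=(xw+zq-1)y+\alpha_1 wq,\\ \frac{dz}{dt}&=-(zq-\alpha_0)z-\frac{\eta}{2},\\ \frac{dw}{dt}&=(xw-zq-\alpha_2)w+yz,\\ \frac{dq}{dt}&=(zq-xw-\alpha_0)q+xy \end{aligned}$$ has the first integral $y-wq$ in the following sense: along every solution, $$\frac{d(y-wq)}{dt}=-(y-wq).$$
   Context: Here $x,y,z,w,q$ are unknown complex functions of the complex variable $t$. The term "first integral" is used for the displayed relation (which determines $y-wq$ up to a constant factor as $e^{-t}$), not for a quantity constant in $t$. *)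

theory Defs
  imports "HOL-Analysis.Analysis"
begin

text \<open>
  Solutions are tuples of complex functions that are complex differentiable at every point of an
  open set of the \<open>t\<close>-plane and satisfy the system there. The domain is an arbitrary open set
  because solutions may be merely local, and may have movable singularities, which are then left
  out of the domain.
\<close>

definition solves_system ::
  "complex \<Rightarrow> complex \<Rightarrow> complex \<Rightarrow> complex \<Rightarrow> complex set \<Rightarrow>
   (complex \<Rightarrow> complex) \<Rightarrow> (complex \<Rightarrow> complex) \<Rightarrow> (complex \<Rightarrow> complex) \<Rightarrow>
   (complex \<Rightarrow> complex) \<Rightarrow> (complex \<Rightarrow> complex) \<Rightarrow> bool"
  where
  "solves_system \<alpha>0 \<alpha>1 \<alpha>2 \<eta> S x y z w q \<longleftrightarrow>
     open S \<and>
     (\<forall>t\<in>S.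
        (x has_field_derivative (- (x t * w t - \<alpha>2) * x t + 1 / 2)) (at t) \<and>
        (y has_field_derivative ((x t * w t + z t * q t - 1) * y t + \<alpha>1 * w t * q t)) (at t) \<and>
        (z has_field_derivative (- (z t * q t - \<alpha>0) * z t - \<eta> / 2)) (at t) \<and>
        (w has_field_derivative ((x t * w t - z t * q t - \<alpha>2) * w t + y t * z t)) (at t) \<and>
        (q has_field_derivative ((z t * q t - x t * w t - \<alpha>0) * q t + x t * y t)) (at t))"

end

theory Submission
  imports Defs
begin

text \<open>
  In \<open>w' q + w q'\<close> the two factors \<open>xw - zq\<close> and \<open>zq - xw\<close> cancel, which leaves
  \<open>(xw + zq) y - (\<alpha>0 + \<alpha>2) wq\<close>. The first summand is exactly the cubic part of \<open>y'\<close>, so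
  \<open>(y - wq)' = - y + (\<alpha>0 + \<alpha>1 + \<alpha>2) wq\<close>, and the normalisation of the parameters turns the last
  coefficient into \<open>1\<close>.
\<close>

theorem proposition4p1:
  fixes \<alpha>0 \<alpha>1 \<alpha>2 \<eta> :: complex
    and S :: "complex set"
    and x y z w q :: "complex \<Rightarrow> complex"
  assumes "\<alpha>0 + \<alpha>1 + \<alpha>2 = 1"
    and "solves_system \<alpha>0 \<alpha>1 \<alpha>2 \<eta> S x y z w q"
  shows "\<forall>t\<in>S. ((\<lambda>s. y s - w s * q s) has_field_derivative - (y t - w t * q t)) (at t)"
proof
  fix t assume "t \<in> S"
  let ?y' = "(x t * w t + z t * q t - 1) * y t + \<alpha>1 * w t * q t"
  let ?w' = "(x t * w t - z t * q t - \<alpha>2) * w t + y t * z t"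
  let ?q' = "(z t * q t - x t * w t - \<alpha>0) * q t + x t * y t"
  have y: "(y has_field_derivative ?y') (at t)"
    and w: "(w has_field_derivative ?w') (at t)"
    and q: "(q has_field_derivative ?q') (at t)"
    using assms(2) \<open>t \<in> S\<close> unfolding solves_system_def by blast+
  have "((\<lambda>s. y s - w s * q s) has_field_derivative ?y' - (?w' * q t + ?q' * w t)) (at t)"
    by (intro DERIV_diff DERIV_mult y w q)
  moreover have "?y' - (?w' * q t + ?q' * w t) = - y t + (\<alpha>0 + \<alpha>1 + \<alpha>2) * (w t * q t)"
    by (simp add: algebra_simps)
  ultimately show
    "((\<lambda>s. y s - w s * q s) has_field_derivative - (y t - w t * q t)) (at t)"
    using assms(1) by simp
qed

end
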